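(* Let $(T_n)_{n\ge1}$ be a perturbed random walk. The following assertions are equivalent: (i) $(T_n)_{n\ge1}$ is positively divergent. (ii) $N(x)<\infty$ a.s. for some/all $x\in\mathbb{R}$. (iii) $\rho(x)<\infty$ a.s. for some/all $x\in\mathbb{R}$.
   Context: Let $(\xi,\eta),(\xi_1,\eta_1),(\xi_2,\eta_2),\ldots$ be i.i.d. $\mathbb{R}^2$-valued random vectors; no condition is imposed on the dependence between $\xi$ and $\eta$. Put $S_0:=0$, $S_n:=\xi_1+\cdots+\xi_n$ for $n\in\mathbb{N}=\{1,2,\ldots\}$, and $T_n:=S_{n-1}+\eta_n$ for $n\in\mathbb{N}$; $(T_n)_{n\ge1}$ is called a perturbed random walk. Standing assumption: $\mathbb{P}\{\xi=0\}<1$ and $\mathbb{P}\{\eta=0\}<1$. The perturbed random walk is called positively divergent if $\lim_{n\to\infty}T_n=\infty$ a.s. For $x\in\mathbb{R}$, $N(x):=\#\{n\in\mathbb{N}:T_n\le x\}$ and $\rho(x):=\sup\{n\in\mathbb{N}:T_n\le x\}$, with $\sup\emptyset:=0$. An assertion "for some/all $x$" in a list of equivalent assertions means that both the version with "for some $x$" and the version with "for all $x$" belong to the list of equivalent assertions. *)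

theory Defs
  imports "HOL-Probability.Probability" "HOL-Library.Extended_Nat"
begin

(* The sequences are used at the indices n >= 1 only; the values at 0 are irrelevant.
   The generic copy (xi, eta) only names the common law, so its standing assumption is
   imposed on (xi 1, eta 1). Independence is that of the pairs: xi n and eta n may be
   dependent in any way. *)
locale perturbed_random_walk = prob_space M for M :: "'a measure" +
  fixes xi eta :: "nat \<Rightarrow> 'a \<Rightarrow> real"
  assumes indep: "indep_vars (\<lambda>_. borel :: (real \<times> real) measure)
                    (\<lambda>n \<omega>. (xi n \<omega>, eta n \<omega>)) {1..}"
    and ident_distr: "\<And>n. n \<ge> 1 \<Longrightarrow>
          distr M (borel :: (real \<times> real) measure) (\<lambda>\<omega>. (xi n \<omega>, eta n \<omega>)) =
          distr M borel (\<lambda>\<omega>. (xi 1 \<omega>, eta 1 \<omega>))"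
    and xi_nonzero: "prob {\<omega> \<in> space M. xi 1 \<omega> = 0} < 1"
    and eta_nonzero: "prob {\<omega> \<in> space M. eta 1 \<omega> = 0} < 1"

definition walk :: "(nat \<Rightarrow> 'a \<Rightarrow> real) \<Rightarrow> nat \<Rightarrow> 'a \<Rightarrow> real" where
  "walk xi n \<omega> = (\<Sum>k=1..n. xi k \<omega>)"

(* Meaningful for n >= 1 only. *)
definition perturbed_walk ::
    "(nat \<Rightarrow> 'a \<Rightarrow> real) \<Rightarrow> (nat \<Rightarrow> 'a \<Rightarrow> real) \<Rightarrow> nat \<Rightarrow> 'a \<Rightarrow> real" where
  "perturbed_walk xi eta n \<omega> = walk xi (n - 1) \<omega> + eta n \<omega>"

definition positively_divergent :: "'a measure \<Rightarrow> (nat \<Rightarrow> 'a \<Rightarrow> real) \<Rightarrow> bool" where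
  "positively_divergent M T \<longleftrightarrow> (AE \<omega> in M. filterlim (\<lambda>n. T n \<omega>) at_top sequentially)"

definition visits :: "(nat \<Rightarrow> 'a \<Rightarrow> real) \<Rightarrow> real \<Rightarrow> 'a \<Rightarrow> nat set" where
  "visits T x \<omega> = {n. n \<ge> 1 \<and> T n \<omega> \<le> x}"

definition num_visits :: "(nat \<Rightarrow> 'a \<Rightarrow> real) \<Rightarrow> real \<Rightarrow> 'a \<Rightarrow> enat" where
  "num_visits T x \<omega> =
     (if finite (visits T x \<omega>) then enat (card (visits T x \<omega>)) else \<infinity>)"

(* In enat the supremum of the empty set is 0, and that of an unbounded set is infinity. *)
definition last_exit :: "(nat \<Rightarrow> 'a \<Rightarrow> real) \<Rightarrow> real \<Rightarrow> 'a \<Rightarrow> enat" where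
  "last_exit T x \<omega> = (SUP n\<in>visits T x \<omega>. enat n)"

end

theory Submission imports Defs begin

text \<open>Splitting off the first \<open>k\<close> steps gives \<open>T\<^sub>n\<^sub>+\<^sub>k = S\<^sub>k + T'\<^sub>n\<close>, where \<open>T'\<close> has the law of \<open>T\<close> and is
  independent of \<open>S\<^sub>k\<close>. Suppose \<open>N(x) < \<infinity>\<close> a.s. If \<open>\<xi>\<close> is at most \<open>-c\<close> with positive
  probability for some \<open>c > 0\<close>, then \<open>k = 1\<close> shows that \<open>N'(x + c) < \<infinity>\<close> on the event
  \<open>\<xi>\<^sub>1 \<le> -c\<close>, which is independent of \<open>N'\<close>; hence \<open>N(x + c) < \<infinity>\<close> a.s. Otherwise
  \<open>\<xi> \<ge> 0\<close> a.s. and \<open>\<xi> \<ge> c\<close> with positive probability for some \<open>c > 0\<close>, so almost surely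
  \<open>S\<^sub>k \<ge> c\<close> for some \<open>k\<close>, and \<open>N(x + c) \<le> k + N'(x) < \<infinity>\<close>. Iterating,
  \<open>N(y) < \<infinity>\<close> a.s. for all \<open>y\<close>, which for integer \<open>y\<close> is divergence.\<close>

section \<open>Finiteness of \<open>visits\<close> along a single path\<close>

lemma num_visits_finite_iff: "num_visits T x \<omega> < \<infinity> \<longleftrightarrow> finite (visits T x \<omega>)"
  by (simp add: num_visits_def)

text \<open>A set of naturals is finite iff it is bounded, so \<open>last_exit\<close> and
  \<open>num_visits\<close> are finite on exactly the same paths. This reduces both lists of
  assertions to one.\<close>

lemma last_exit_finite_iff: "last_exit T x \<omega> < \<infinity> \<longleftrightarrow> finite (visits T x \<omega>)"
proof
  assume "last_exit T x \<omega> < \<infinity>"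
  then obtain m where m: "last_exit T x \<omega> = enat m"
    by (cases "last_exit T x \<omega>") auto
  have "n \<le> m" if "n \<in> visits T x \<omega>" for n
  proof -
    have "enat n \<le> last_exit T x \<omega>"
      unfolding last_exit_def by (intro SUP_upper that)
    then show ?thesis using m by simp
  qed
  then show "finite (visits T x \<omega>)"
    by (auto simp: finite_nat_set_iff_bounded_le)
next
  assume "finite (visits T x \<omega>)"
  then obtain m where "\<forall>n\<in>visits T x \<omega>. n \<le> m"
    by (auto simp: finite_nat_set_iff_bounded_le)
  then have "last_exit T x \<omega> \<le> enat m"
    unfolding last_exit_def by (intro SUP_least) auto
  then show "last_exit T x \<omega> < \<infinity>"
    using enat_ord_code(4) le_less_trans by blast
qed

lemma visits_mono: "x \<le> y \<Longrightarrow> visits T x \<omega> \<subseteq> visits T y \<omega>"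
  by (auto simp: visits_def)

lemma visits_cong:
  assumes "\<And>n. n \<ge> 1 \<Longrightarrow> T n \<omega> = T' n \<omega>'"
  shows "visits T x \<omega> = visits T' x \<omega>'"
  using assms by (auto simp: visits_def)

text \<open>Natural levels suffice by the Archimedean property. Being countable, they allow an
  almost sure statement to be checked one level at a time.\<close>

lemma filterlim_at_top_iff_finite_visits:
  "filterlim (\<lambda>n. T n \<omega>) at_top sequentially \<longleftrightarrow> (\<forall>m::nat. finite (visits T (real m) \<omega>))"
proof
  assume lim: "filterlim (\<lambda>n. T n \<omega>) at_top sequentially"
  show "\<forall>m::nat. finite (visits T (real m) \<omega>)"
  proof
    fix m :: nat
    from lim have "\<forall>\<^sub>F n in sequentially. T n \<omega> > real m"
      by (simp add: filterlim_at_top_dense)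
    then obtain n0 where n0: "\<forall>n\<ge>n0. T n \<omega> > real m"
      by (auto simp: eventually_sequentially)
    have "visits T (real m) \<omega> \<subseteq> {..n0}"
    proof
      fix n assume "n \<in> visits T (real m) \<omega>"
      then have "\<not> T n \<omega> > real m" by (simp add: visits_def)
      with n0 have "\<not> n0 \<le> n" by blast
      then show "n \<in> {..n0}" by simp
    qed
    then show "finite (visits T (real m) \<omega>)"
      by (rule finite_subset) simp
  qed
next
  assume fin: "\<forall>m::nat. finite (visits T (real m) \<omega>)"
  show "filterlim (\<lambda>n. T n \<omega>) at_top sequentially"
    unfolding filterlim_at_top
  proof
    fix Z :: real
    obtain m :: nat where m: "Z \<le> real m"
      using real_arch_simple by blast
    obtain n0 where n0: "\<forall>n\<in>visits T (real m) \<omega>. n \<le> n0"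
      using fin by (auto simp: finite_nat_set_iff_bounded_le)
    have "Z \<le> T n \<omega>" if "n \<ge> Suc n0" for n
    proof -
      have "n \<notin> visits T (real m) \<omega>" using n0 that by fastforce
      then show ?thesis using that m by (simp add: visits_def)
    qed
    then show "\<forall>\<^sub>F n in sequentially. Z \<le> T n \<omega>"
      unfolding eventually_sequentially by blast
  qed
qed

lemma walk_add: "walk xi (k + n) \<omega> = walk xi k \<omega> + walk (\<lambda>i. xi (i + k)) n \<omega>"
  by (induction n) (simp_all add: walk_def ac_simps)

text \<open>Indices up to \<open>k\<close> contribute only finitely many visits. Beyond
  \<open>k\<close>, the walk equals \<open>walk xi k\<close> plus the walk restarted after
  \<open>k\<close> steps, so those visits are the visits of the restarted walk to the lowered level,
  moved by \<open>k\<close>.\<close>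

lemma infinite_visits_shift:
  "infinite (visits (perturbed_walk xi eta) x \<omega>) \<longleftrightarrow>
   infinite (visits (perturbed_walk (\<lambda>n. xi (n + k)) (\<lambda>n. eta (n + k))) (x - walk xi k \<omega>) \<omega>)"
  (is "infinite ?V \<longleftrightarrow> infinite ?W")
proof -
  have T: "perturbed_walk xi eta (n + k) \<omega> =
      walk xi k \<omega> + perturbed_walk (\<lambda>n. xi (n + k)) (\<lambda>n. eta (n + k)) n \<omega>" if "n \<ge> 1" for n
  proof -
    from that have "n + k - 1 = k + (n - 1)" by simp
    then show ?thesis by (simp add: perturbed_walk_def walk_add)
  qed
  have "?V \<inter> {k<..} = (\<lambda>n. n + k) ` ?W"
  proof (intro equalityI subsetI)
    fix n assume n: "n \<in> ?V \<inter> {k<..}"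
    then have "n - k \<in> ?W"
      using T[of "n - k"] by (auto simp: visits_def)
    with n show "n \<in> (\<lambda>n. n + k) ` ?W"
      by (intro image_eqI[of _ _ "n - k"]) auto
  next
    fix n assume "n \<in> (\<lambda>n. n + k) ` ?W"
    then obtain m where m: "n = m + k" "m \<in> ?W" by blast
    then show "n \<in> ?V \<inter> {k<..}"
      using T[of m] by (simp add: visits_def)
  qed
  then have "finite (?V \<inter> {k<..}) \<longleftrightarrow> finite ?W"
    by (simp add: finite_image_iff)
  moreover have "?V = (?V \<inter> {..k}) \<union> (?V \<inter> {k<..})"
    by auto
  then have "finite ?V \<longleftrightarrow> finite (?V \<inter> {k<..})"
    by (metis finite_Int finite_Un finite_atMost)
  ultimately show ?thesis by blast
qed

text \<open>Countable quantifiers make the event visibly measurable. The bound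
  \<open>max 1 m\<close> keeps the index in the range where \<open>T n\<close> is known to be
  measurable.\<close>

lemma infinite_visits_iff:
  "infinite (visits T x \<omega>) \<longleftrightarrow> (\<forall>m. \<exists>n\<in>{max 1 m..}. T n \<omega> \<le> x)"
  by (simp add: infinite_nat_iff_unbounded_le visits_def Bex_def conj_ac)

lemma measurable_perturbed_walk:
  assumes [measurable]: "\<And>n. n \<ge> 1 \<Longrightarrow> xi n \<in> borel_measurable M"
    "\<And>n. n \<ge> 1 \<Longrightarrow> eta n \<in> borel_measurable M"
  shows "n \<ge> 1 \<Longrightarrow> perturbed_walk xi eta n \<in> borel_measurable M"
  unfolding perturbed_walk_def[abs_def] walk_def[abs_def] by measurable

lemma sets_infinite_visits:
  assumes "\<And>n. n \<ge> 1 \<Longrightarrow> T n \<in> borel_measurable M"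
  shows "{\<omega> \<in> space M. infinite (visits T x \<omega>)} \<in> sets M"
  unfolding infinite_visits_iff using assms
  by (intro sets.sets_Collect_countable_All sets.sets_Collect_countable_Ex' borel_measurable_le) auto

section \<open>Reindexed independence and positive thresholds\<close>

lemma (in prob_space) indep_vars_reindex:
  assumes "inj_on f I" "indep_vars M' X (f ` I)"
  shows "indep_vars (\<lambda>i. M' (f i)) (\<lambda>i. X (f i)) I"
  unfolding indep_vars_def2
proof (intro conjI ballI indep_setsI)
  fix i assume "i \<in> I"
  then show "random_variable (M' (f i)) (X (f i))"
    using assms(2) by (auto simp: indep_vars_def2)
  then show "{X (f i) -` A \<inter> space M |A. A \<in> sets (M' (f i))} \<subseteq> events"
    by auto
next
  fix A J
  assume J: "J \<noteq> {}" "J \<subseteq> I" "finite J"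
    and A: "\<forall>j\<in>J. A j \<in> {X (f j) -` A \<inter> space M |A. A \<in> sets (M' (f j))}"
  define g where "g = the_inv_into I f"
  have g: "g (f j) = j" if "j \<in> J" for j
    using that J assms(1) by (auto simp: g_def the_inv_into_f_f)
  have "prob (\<Inter>j\<in>f ` J. A (g j)) = (\<Prod>j\<in>f ` J. prob (A (g j)))"
    using assms(2) J A g unfolding indep_vars_def2
    by (intro indep_setsD[where I="f ` I" and F="\<lambda>i. {X i -` A \<inter> space M |A. A \<in> sets (M' i)}"]) auto
  moreover have "(\<Prod>j\<in>f ` J. prob (A (g j))) = (\<Prod>j\<in>J. prob (A j))"
    using inj_on_subset[OF assms(1) J(2)] g by (simp add: prod.reindex)
  ultimately show "prob (\<Inter>j\<in>J. A j) = (\<Prod>j\<in>J. prob (A j))"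
    using g by simp
qed

text \<open>The event \<open>X > 0\<close> is the countable union of the events
  \<open>X \<ge> 1 / Suc n\<close>, which cannot all be null.\<close>

lemma (in prob_space) prob_pos_imp_ge_pos:
  fixes X :: "'a \<Rightarrow> real"
  assumes [measurable]: "X \<in> borel_measurable M"
    and "prob {\<omega> \<in> space M. X \<omega> > 0} > 0"
  shows "\<exists>c>0. prob {\<omega> \<in> space M. X \<omega> \<ge> c} > 0"
proof (rule ccontr)
  assume "\<not> ?thesis"
  then have "prob {\<omega> \<in> space M. X \<omega> \<ge> c} = 0" if "c > 0" for c
    using that by (auto simp: zero_less_measure_iff)
  then have "AE \<omega> in M. \<not> X \<omega> \<ge> 1 / real (Suc n)" for n
    by (subst prob_Collect_eq_0[symmetric]) simp_all
  then have "AE \<omega> in M. \<forall>n. \<not> X \<omega> \<ge> 1 / real (Suc n)"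
    by (simp add: AE_all_countable)
  then have "AE \<omega> in M. \<not> X \<omega> > 0"
  proof (rule AE_mp, intro AE_I2 impI)
    fix \<omega> assume *: "\<forall>n. \<not> X \<omega> \<ge> 1 / real (Suc n)"
    show "\<not> X \<omega> > 0"
      using * reals_Archimedean[of "X \<omega>"] by (auto simp: inverse_eq_divide dest: less_imp_le)
  qed
  then have "prob {\<omega> \<in> space M. X \<omega> > 0} = 0"
    by (subst prob_Collect_eq_0) simp_all
  with assms(2) show False by simp
qed

section \<open>Stationarity and independence of the increment pairs\<close>

context perturbed_random_walk
begin

definition increment :: "nat \<Rightarrow> 'a \<Rightarrow> real \<times> real" where
  "increment n \<omega> = (xi n \<omega>, eta n \<omega>)"

abbreviation shifted_walk :: "nat \<Rightarrow> nat \<Rightarrow> 'a \<Rightarrow> real" where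
  "shifted_walk k \<equiv> perturbed_walk (\<lambda>n. xi (n + k)) (\<lambda>n. eta (n + k))"

text \<open>The shifted walk as a functional on sequence space: the sample point is the sequence
  \<open>f\<close> of pairs itself. For \<open>n \<ge> 1\<close> only coordinates beyond
  \<open>k\<close> are read.\<close>

abbreviation path_walk :: "nat \<Rightarrow> nat \<Rightarrow> (nat \<Rightarrow> real \<times> real) \<Rightarrow> real" where
  "path_walk k \<equiv> perturbed_walk (\<lambda>n f. fst (f (n + k))) (\<lambda>n f. snd (f (n + k)))"

lemma indep_increment: "indep_vars (\<lambda>_. borel) increment {1..}"
  using indep by (simp add: increment_def[abs_def])

lemma measurable_increment: "n \<ge> 1 \<Longrightarrow> increment n \<in> borel_measurable M"
  using indep_increment by (auto simp: indep_vars_def)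

lemma measurable_xi: "n \<ge> 1 \<Longrightarrow> xi n \<in> borel_measurable M"
  and measurable_eta: "n \<ge> 1 \<Longrightarrow> eta n \<in> borel_measurable M"
proof -
  assume "n \<ge> 1"
  from measurable_increment[OF this]
  have "(\<lambda>\<omega>. fst (increment n \<omega>)) \<in> borel_measurable M" "(\<lambda>\<omega>. snd (increment n \<omega>)) \<in> borel_measurable M"
    unfolding borel_prod[symmetric] by simp_all
  then show "xi n \<in> borel_measurable M" "eta n \<in> borel_measurable M"
    by (simp_all add: increment_def)
qed

lemma sets_infinite_visits_shifted:
  "{\<omega> \<in> space M. infinite (visits (shifted_walk k) x \<omega>)} \<in> events"
  by (intro sets_infinite_visits measurable_perturbed_walk measurable_xi measurable_eta) auto

lemma sets_infinite_visits_path: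
  assumes "{k<..} \<subseteq> I"
  shows "{f \<in> space (Pi\<^sub>M I (\<lambda>_. borel)). infinite (visits (path_walk k) x f)} \<in> sets (Pi\<^sub>M I (\<lambda>_. borel))"
proof -
  have "(\<lambda>f. f (n + k)) \<in> Pi\<^sub>M I (\<lambda>_. borel) \<rightarrow>\<^sub>M (borel \<Otimes>\<^sub>M borel :: (real \<times> real) measure)"
    if "n \<ge> 1" for n
    unfolding borel_prod using that assms by (intro measurable_component_singleton) auto
  then show ?thesis
    by (intro sets_infinite_visits measurable_perturbed_walk) simp_all
qed

text \<open>Links path space to \<open>M\<close>. The shift \<open>j\<close> of the input serves
  stationarity (with \<open>k = 0\<close>), the shift \<open>k\<close> of the functional serves
  independence (with \<open>k = 1\<close>, \<open>j = 0\<close>).\<close>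

lemma visits_path_walk:
  assumes "{k<..} \<subseteq> I"
  shows "visits (path_walk k) x (\<lambda>i\<in>I. increment (i + j) \<omega>) = visits (shifted_walk (k + j)) x \<omega>"
  using assms
  by (intro visits_cong arg_cong2[where f="(+)"] sum.cong)
     (auto simp: perturbed_walk_def walk_def increment_def subset_iff ac_simps intro!: sum.cong)

lemma distr_increments_shift:
  "distr M (Pi\<^sub>M {1..} (\<lambda>_. borel)) (\<lambda>\<omega>. \<lambda>n\<in>{1..}. increment (n + k) \<omega>) =
   Pi\<^sub>M {1..} (\<lambda>_. distr M borel (increment 1))"
proof -
  \<comment> \<open>Reindexing keeps the index set \<open>{1..}\<close>, so all shifts have their
    laws on the same product space and can be compared.\<close>
  have "indep_vars (\<lambda>_. borel) (\<lambda>n. increment (n + k)) {1..}"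
    by (rule indep_vars_reindex[OF _ indep_vars_subset[OF indep_increment]]) auto
  then have "distr M (Pi\<^sub>M {1..} (\<lambda>_. borel)) (\<lambda>\<omega>. \<lambda>n\<in>{1..}. increment (n + k) \<omega>) =
      Pi\<^sub>M {1..} (\<lambda>n. distr M borel (increment (n + k)))"
    by (subst (asm) indep_vars_iff_distr_eq_PiM') (auto intro: measurable_increment)
  also have "\<dots> = Pi\<^sub>M {1..} (\<lambda>_. distr M borel (increment 1))"
    unfolding increment_def[abs_def] by (intro PiM_cong refl ident_distr) auto
  finally show ?thesis .
qed

text \<open>Both events are preimages of one set \<open>?A\<close> of paths, under increment
  sequences that have the same law.\<close>

lemma prob_infinite_visits_shifted:
  "prob {\<omega> \<in> space M. infinite (visits (shifted_walk k) x \<omega>)} =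
   prob {\<omega> \<in> space M. infinite (visits (perturbed_walk xi eta) x \<omega>)}"
proof -
  let ?P = "Pi\<^sub>M {1..} (\<lambda>_. borel) :: (nat \<Rightarrow> real \<times> real) measure"
  let ?A = "{f \<in> space ?P. infinite (visits (path_walk 0) x f)}"
  have *: "prob {\<omega> \<in> space M. infinite (visits (shifted_walk j) x \<omega>)} =
      measure (Pi\<^sub>M {1..} (\<lambda>_. distr M borel (increment 1))) ?A" for j
  proof -
    have meas: "(\<lambda>\<omega>. \<lambda>n\<in>{1..}. increment (n + j) \<omega>) \<in> M \<rightarrow>\<^sub>M ?P"
      by (intro measurable_restrict measurable_increment) auto
    have sub: "{0<..} \<subseteq> {1::nat..}" by auto
    have "measure (Pi\<^sub>M {1..} (\<lambda>_. distr M borel (increment 1))) ?A =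
        prob ((\<lambda>\<omega>. \<lambda>n\<in>{1..}. increment (n + j) \<omega>) -` ?A \<inter> space M)"
      unfolding distr_increments_shift[of j, symmetric]
      by (intro measure_distr meas sets_infinite_visits_path sub)
    also have "(\<lambda>\<omega>. \<lambda>n\<in>{1..}. increment (n + j) \<omega>) -` ?A \<inter> space M =
        {\<omega> \<in> space M. infinite (visits (shifted_walk j) x \<omega>)}"
      using measurable_space[OF meas] visits_path_walk[OF sub, of x j] by auto
    finally show ?thesis by simp
  qed
  show ?thesis
    using *[of k] *[of 0] by simp
qed

lemma AE_finite_visits_shifted:
  "(AE \<omega> in M. finite (visits (shifted_walk k) x \<omega>)) \<longleftrightarrow>
   (AE \<omega> in M. finite (visits (perturbed_walk xi eta) x \<omega>))"
  using prob_Collect_eq_0[OF sets_infinite_visits_shifted[of k x]]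
    prob_Collect_eq_0[OF sets_infinite_visits_shifted[of 0 x]] prob_infinite_visits_shifted[of k x]
  by simp

text \<open>The first event depends on coordinate 1 only, the second on coordinates above 1 only;
  disjoint blocks of independent increments are independent.\<close>

lemma indep_first_step_shifted:
  "prob {\<omega> \<in> space M. xi 1 \<omega> \<le> a \<and> infinite (visits (shifted_walk 1) x \<omega>)} =
   prob {\<omega> \<in> space M. xi 1 \<omega> \<le> a} *
   prob {\<omega> \<in> space M. infinite (visits (shifted_walk 1) x \<omega>)}"
proof -
  let ?P = "\<lambda>I. Pi\<^sub>M I (\<lambda>_. borel) :: (nat \<Rightarrow> real \<times> real) measure"
  let ?R = "\<lambda>I \<omega>. \<lambda>n\<in>I. increment n \<omega>"
  let ?A = "{f \<in> space (?P {1}). fst (f 1) \<le> a}"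
  let ?B = "{f \<in> space (?P {1<..}). infinite (visits (path_walk 1) x f)}"
  have ind: "indep_var (?P {1}) (?R {1}) (?P {1<..}) (?R {1<..})"
    by (rule indep_var_restrict[OF indep_increment]) auto
  have "(\<lambda>f. f 1) \<in> ?P {1} \<rightarrow>\<^sub>M (borel \<Otimes>\<^sub>M borel :: (real \<times> real) measure)"
    unfolding borel_prod by (intro measurable_component_singleton) auto
  then have A: "?A \<in> sets (?P {1})" by measurable
  have B: "?B \<in> sets (?P {1<..})"
    by (rule sets_infinite_visits_path) simp
  have "?R {1} -` ?A \<inter> space M = {\<omega> \<in> space M. xi 1 \<omega> \<le> a}"
    using measurable_space[OF indep_var_rv1[OF ind]] by (auto simp: increment_def)
  moreover have "?R {1<..} -` ?B \<inter> space M = {\<omega> \<in> space M. infinite (visits (shifted_walk 1) x \<omega>)}"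
    using measurable_space[OF indep_var_rv2[OF ind]] visits_path_walk[of 1 "{1<..}" x 0] by auto
  moreover have "(\<lambda>\<omega>. (?R {1} \<omega>, ?R {1<..} \<omega>)) -` (?A \<times> ?B) \<inter> space M =
      (?R {1} -` ?A \<inter> space M) \<inter> (?R {1<..} -` ?B \<inter> space M)"
    by auto
  ultimately show ?thesis
    using indep_varD[OF ind A B] by (simp add: Collect_conj_eq[symmetric] Int_def conj_ac)
qed

section \<open>Laws of the single steps, and occurrence of a large step\<close>

lemma prob_xi:
  assumes "n \<ge> 1" "A \<in> sets borel"
  shows "prob {\<omega> \<in> space M. xi n \<omega> \<in> A} = prob {\<omega> \<in> space M. xi 1 \<omega> \<in> A}"
proof -
  have A: "fst -` A \<in> sets (borel :: (real \<times> real) measure)"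
    using measurable_sets[OF measurable_fst[of borel "borel :: real measure"] assms(2)]
    unfolding borel_prod by simp
  have *: "prob {\<omega> \<in> space M. xi m \<omega> \<in> A} = measure (distr M borel (increment m)) (fst -` A)"
    if "m \<ge> 1" for m
    using that by (subst measure_distr[OF measurable_increment A])
      (auto simp: increment_def intro!: arg_cong[where f=prob])
  show ?thesis
    using *[of n] *[of 1] ident_distr[OF assms(1)] assms(1) by (simp add: increment_def[abs_def])
qed

text \<open>By independence the first \<open>n\<close> steps all stay below \<open>c\<close> with
  probability \<open>q ^ n\<close>, where \<open>q < 1\<close>; this tends to 0.\<close>

lemma AE_ex_xi_ge:
  assumes pos: "prob {\<omega> \<in> space M. xi 1 \<omega> \<ge> c} > 0"
  shows "AE \<omega> in M. \<exists>k\<ge>1. xi k \<omega> \<ge> c"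
proof -
  define q where "q = prob {\<omega> \<in> space M. xi 1 \<omega> < c}"
  let ?N = "{\<omega> \<in> space M. \<forall>k\<in>{1..}. xi k \<omega> < c}"
  have ev: "{\<omega> \<in> space M. xi k \<omega> < c} \<in> events" if "k \<ge> 1" for k
    using measurable_xi[OF that] by measurable
  then have "prob {\<omega> \<in> space M. \<not> xi 1 \<omega> < c} = 1 - q"
    unfolding q_def by (intro prob_neg) simp
  then have q: "0 \<le> q" "q < 1" using pos by (simp_all add: q_def not_less)
  have N: "?N \<in> events"
    using ev by (intro sets.sets_Collect_countable_All') auto
  \<comment> \<open>Independence is available for the pairs, so the condition on \<open>xi\<close>
    is expressed as a half-plane for \<open>increment\<close>.\<close>
  have half: "{p. fst p < c} \<in> sets (borel :: (real \<times> real) measure)"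
    by (simp add: borel_open open_Collect_less continuous_on_fst)
  have "prob ?N \<le> q ^ n" if "n \<ge> 1" for n
  proof -
    have "prob ?N \<le> prob (\<Inter>k\<in>{1..n}. increment k -` {p. fst p < c} \<inter> space M)"
      using that half
      by (intro finite_measure_mono sets.finite_INT measurable_sets[OF measurable_increment])
         (auto simp: increment_def not_le)
    also have "\<dots> = (\<Prod>k\<in>{1..n}. prob (increment k -` {p. fst p < c} \<inter> space M))"
      using that half by (intro indep_varsD[OF indep_increment]) auto
    also have "\<dots> = (\<Prod>k\<in>{1..n}. q)"
    proof (rule prod.cong[OF refl])
      fix k assume "k \<in> {1..n}"
      then show "prob (increment k -` {p. fst p < c} \<inter> space M) = q"
        using prob_xi[of k "{..<c}"]
        by (simp add: q_def increment_def vimage_def Int_def conj_commute)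
    qed
    also have "\<dots> = q ^ n" by simp
    finally show ?thesis .
  qed
  then have "prob ?N \<le> 0"
    using LIMSEQ_power_zero[of q] q by (intro LIMSEQ_le_const[of "\<lambda>n. q ^ n"]) auto
  then have "AE \<omega> in M. \<not> (\<forall>k\<in>{1..}. xi k \<omega> < c)"
    using prob_Collect_eq_0[OF N] by (simp add: measure_le_0_iff)
  then show ?thesis
    by eventually_elim (auto simp: not_less)
qed

section \<open>Raising the level from \<open>x\<close> to \<open>x + c\<close>\<close>

lemma AE_finite_visits_step_negative:
  assumes pos: "prob {\<omega> \<in> space M. xi 1 \<omega> \<le> - c} > 0"
    and fin: "AE \<omega> in M. finite (visits (perturbed_walk xi eta) x \<omega>)"
  shows "AE \<omega> in M. finite (visits (perturbed_walk xi eta) (x + c) \<omega>)"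
proof -
  let ?S = "{\<omega> \<in> space M. xi 1 \<omega> \<le> - c \<and> infinite (visits (shifted_walk 1) (x + c) \<omega>)}"
  have "?S = {\<omega> \<in> space M. xi 1 \<omega> \<le> - c} \<inter> {\<omega> \<in> space M. infinite (visits (shifted_walk 1) (x + c) \<omega>)}"
    by auto
  also have "\<dots> \<in> events"
    by (intro sets.Int sets_infinite_visits_shifted borel_measurable_le measurable_xi) auto
  finally have S: "?S \<in> events" .
  have "AE \<omega> in M. \<not> (xi 1 \<omega> \<le> - c \<and> infinite (visits (shifted_walk 1) (x + c) \<omega>))"
    using fin
  proof eventually_elim
    case (elim \<omega>)
    then have "finite (visits (shifted_walk 1) (x - walk xi 1 \<omega>) \<omega>)"
      using infinite_visits_shift[of xi eta x \<omega> 1] by blast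
    \<comment> \<open>Here \<open>walk xi 1\<close> is just \<open>xi 1\<close>, so
      \<open>x - walk xi 1 \<omega>\<close> is at least \<open>x + c\<close>.\<close>
    then have "finite (visits (shifted_walk 1) (x + c) \<omega>)" if "xi 1 \<omega> \<le> - c"
      by (rule finite_subset[rotated]) (use that in \<open>auto simp: walk_def intro!: visits_mono\<close>)
    then show ?case by blast
  qed
  then have "prob ?S = 0"
    using prob_Collect_eq_0[OF S] by blast
  \<comment> \<open>The probability of \<open>?S\<close> factors by independence, and its first
    factor is positive.\<close>
  then have "prob {\<omega> \<in> space M. infinite (visits (shifted_walk 1) (x + c) \<omega>)} = 0"
    using pos by (simp only: indep_first_step_shifted) simp
  then have "AE \<omega> in M. finite (visits (shifted_walk 1) (x + c) \<omega>)"
    using prob_Collect_eq_0[OF sets_infinite_visits_shifted[of 1 "x + c"]] by simp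
  then show ?thesis
    by (simp only: AE_finite_visits_shifted)
qed

lemma AE_finite_visits_step_nonneg:
  assumes nonneg: "AE \<omega> in M. xi 1 \<omega> \<ge> 0"
    and pos: "prob {\<omega> \<in> space M. xi 1 \<omega> \<ge> c} > 0"
    and fin: "AE \<omega> in M. finite (visits (perturbed_walk xi eta) x \<omega>)"
  shows "AE \<omega> in M. finite (visits (perturbed_walk xi eta) (x + c) \<omega>)"
proof -
  have "AE \<omega> in M. xi n \<omega> \<ge> 0" if "n \<ge> 1" for n
  proof -
    have *: "(AE \<omega> in M. xi m \<omega> \<ge> 0) \<longleftrightarrow> prob {\<omega> \<in> space M. xi m \<omega> \<in> {0..}} = 1" if "m \<ge> 1" for m
      using measurable_xi[OF that] by (subst prob_Collect_eq_1) auto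
    show ?thesis
      using *[of n] *[of 1] prob_xi[of n "{0..}"] that nonneg by simp
  qed
  then have "AE \<omega> in M. \<forall>n\<in>{1..}. xi n \<omega> \<ge> 0"
    by (subst AE_ball_countable) auto
  \<comment> \<open>All \<open>k\<close> are treated at once because the index of the large step is
    random.\<close>
  moreover have "AE \<omega> in M. \<forall>k. finite (visits (shifted_walk k) x \<omega>)"
    using fin by (simp add: AE_all_countable AE_finite_visits_shifted)
  ultimately show ?thesis
    using AE_ex_xi_ge[OF pos]
  proof eventually_elim
    case (elim \<omega>)
    then obtain k where k: "k \<ge> 1" "xi k \<omega> \<ge> c" by blast
    have "xi k \<omega> \<le> walk xi k \<omega>"
      unfolding walk_def using k elim by (intro member_le_sum) auto
    then have "visits (shifted_walk k) (x + c - walk xi k \<omega>) \<omega> \<subseteq> visits (shifted_walk k) x \<omega>"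
      using k by (intro visits_mono) simp
    then have "finite (visits (shifted_walk k) (x + c - walk xi k \<omega>) \<omega>)"
      using elim finite_subset by blast
    then show ?case
      using infinite_visits_shift[of xi eta "x + c" \<omega> k] by blast
  qed
qed

text \<open>One \<open>c\<close> serves every level \<open>x\<close>, so the step can be iterated.
  It depends only on the law of \<open>xi 1\<close>, according to whether negative steps have
  positive probability.\<close>

lemma AE_finite_visits_step:
  obtains c where "c > 0"
    "\<And>x. AE \<omega> in M. finite (visits (perturbed_walk xi eta) x \<omega>) \<Longrightarrow>
         AE \<omega> in M. finite (visits (perturbed_walk xi eta) (x + c) \<omega>)"
proof -
  have meas: "xi 1 \<in> borel_measurable M" by (simp add: measurable_xi)
  show thesis
  proof (cases "AE \<omega> in M. xi 1 \<omega> \<ge> 0")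
    case True
    \<comment> \<open>The assumption that \<open>xi 1\<close> is not a.s. zero enters here: together
      with nonnegativity it forces positive steps.\<close>
    have "\<not> (AE \<omega> in M. xi 1 \<omega> = 0)"
      using xi_nonzero prob_Collect_eq_1[of "\<lambda>\<omega>. xi 1 \<omega> = 0"] meas by auto
    moreover have "AE \<omega> in M. xi 1 \<omega> = 0" if "AE \<omega> in M. \<not> xi 1 \<omega> > 0"
      using True that by eventually_elim simp
    ultimately have "\<not> (AE \<omega> in M. \<not> xi 1 \<omega> > 0)" by blast
    then have "prob {\<omega> \<in> space M. xi 1 \<omega> > 0} \<noteq> 0"
      using prob_Collect_eq_0[of "\<lambda>\<omega>. xi 1 \<omega> > 0"] meas by auto
    then have "prob {\<omega> \<in> space M. xi 1 \<omega> > 0} > 0"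
      by (simp add: zero_less_measure_iff)
    then obtain c where "c > 0" "prob {\<omega> \<in> space M. xi 1 \<omega> \<ge> c} > 0"
      using prob_pos_imp_ge_pos[of "xi 1"] meas by auto
    with True show ?thesis by (blast intro: that AE_finite_visits_step_nonneg)
  next
    case False
    then have "prob {\<omega> \<in> space M. - xi 1 \<omega> > 0} \<noteq> 0"
      using prob_Collect_eq_0[of "\<lambda>\<omega>. - xi 1 \<omega> > 0"] meas by (auto simp: not_less)
    then have "prob {\<omega> \<in> space M. - xi 1 \<omega> > 0} > 0"
      by (simp add: zero_less_measure_iff)
    then obtain c where "c > 0" "prob {\<omega> \<in> space M. - xi 1 \<omega> \<ge> c} > 0"
      using prob_pos_imp_ge_pos[of "\<lambda>\<omega>. - xi 1 \<omega>"] meas by auto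
    then have "prob {\<omega> \<in> space M. xi 1 \<omega> \<le> - c} > 0"
      by (simp add: le_minus_iff)
    with \<open>c > 0\<close> show ?thesis by (blast intro: that AE_finite_visits_step_negative)
  qed
qed

section \<open>From one level to all levels, and divergence\<close>

lemma AE_finite_visits_all:
  assumes "AE \<omega> in M. finite (visits (perturbed_walk xi eta) x \<omega>)"
  shows "AE \<omega> in M. finite (visits (perturbed_walk xi eta) y \<omega>)"
proof -
  obtain c where c: "c > 0"
    "\<And>x. AE \<omega> in M. finite (visits (perturbed_walk xi eta) x \<omega>) \<Longrightarrow>
         AE \<omega> in M. finite (visits (perturbed_walk xi eta) (x + c) \<omega>)"
    using AE_finite_visits_step by blast
  have *: "AE \<omega> in M. finite (visits (perturbed_walk xi eta) (x + real m * c) \<omega>)" for m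
  proof (induction m)
    case (Suc m)
    then show ?case using c(2)[OF Suc] by (simp add: algebra_simps)
  qed (use assms in simp)
  obtain m :: nat where "(y - x) / c \<le> real m"
    using real_arch_simple by blast
  then have "y \<le> x + real m * c"
    using c(1) by (simp add: field_simps)
  from *[of m] show ?thesis
    by eventually_elim (rule finite_subset[OF visits_mono[OF \<open>y \<le> x + real m * c\<close>]])
qed

text \<open>Since \<open>x\<close> is arbitrary and the left side does not mention it, this yields
  the versions for some and for all \<open>x\<close> together.\<close>

lemma positively_divergent_iff_AE_finite_visits:
  "positively_divergent M (perturbed_walk xi eta) \<longleftrightarrow>
   (AE \<omega> in M. finite (visits (perturbed_walk xi eta) x \<omega>))"
  unfolding positively_divergent_def filterlim_at_top_iff_finite_visits AE_all_countable
  using AE_finite_visits_all by blast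

end

theorem theorem2p4:
  fixes M :: "'a measure" and xi eta :: "nat \<Rightarrow> 'a \<Rightarrow> real"
  assumes "perturbed_random_walk M xi eta"
  defines "T \<equiv> perturbed_walk xi eta"
  shows "(positively_divergent M T \<longleftrightarrow> (\<exists>x. AE \<omega> in M. num_visits T x \<omega> < \<infinity>))
       \<and> (positively_divergent M T \<longleftrightarrow> (\<forall>x. AE \<omega> in M. num_visits T x \<omega> < \<infinity>))
       \<and> (positively_divergent M T \<longleftrightarrow> (\<exists>x. AE \<omega> in M. last_exit T x \<omega> < \<infinity>))
       \<and> (positively_divergent M T \<longleftrightarrow> (\<forall>x. AE \<omega> in M. last_exit T x \<omega> < \<infinity>))"
  unfolding T_def num_visits_finite_iff last_exit_finite_iff
  using perturbed_random_walk.positively_divergent_iff_AE_finite_visits[OF assms(1)] by blast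

end
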